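(* Let $E$ be a Banach space with the Opial property. If $X$ is a nonempty weakly compact subset of $E$, then $X$ has the unique minimizer property (UMP): for each metric functional $\mathbf{h}\in X^{\diamondsuit}$ there is a point $a\in X$ such that $\mathbf{h}(a)<\mathbf{h}(x)$ for all $x\in X\setminus\{a\}$.
   Context: A Banach space $E$ (with norm $\|\cdot\|$, real scalars) has the Opial property if whenever a sequence $(a_n)$ in $E$ converges weakly to $a$, one has $\liminf_n\|a_n-a\|<\liminf_n\|a_n-x\|$ for all $x\in E$ with $x\ne a$. Metric functionals: let $X$ carry the metric $d(x,y)=\|x-y\|$ and fix a base point $o\in X$. For $w\in X$ define $\mathbf{h}_w:X\to\mathbb{R}$ by $\mathbf{h}_w(x)=d(x,w)-d(o,w)$. $X^{\diamondsuit}$ is the closure of $\{\mathbf{h}_w : w\in X\}$ in $\mathbb{R}^X$ (all functions $X\to\mathbb{R}$) with the topology of pointwise convergence; its elements are the metric functionals on $X$. *)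

theory Defs
  imports "HOL-Analysis.Analysis"
begin

definition weak_topology :: "'a::real_normed_vector topology" where
  "weak_topology =
     topology_generated_by {blinfun_apply f -` U | (f :: 'a \<Rightarrow>\<^sub>L real) U. open U}"

lemma topspace_weak_topology [simp]: "topspace weak_topology = UNIV"
proof -
  have "(UNIV :: 'a set) \<in> {blinfun_apply f -` U | (f :: 'a \<Rightarrow>\<^sub>L real) U. open U}"
    by (auto intro!: exI[of _ 0] exI[of _ UNIV])
  then show ?thesis
    unfolding weak_topology_def topology_generated_by_topspace by blast
qed

lemma limitin_weak_topology:
  "limitin weak_topology s l F \<longleftrightarrow>
     (\<forall>f :: 'a::real_normed_vector \<Rightarrow>\<^sub>L real. ((\<lambda>n. f (s n)) \<longlongrightarrow> f l) F)"
proof safe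
  fix f :: "'a \<Rightarrow>\<^sub>L real"
  assume lim: "limitin weak_topology s l F"
  show "((\<lambda>n. f (s n)) \<longlongrightarrow> f l) F"
  proof (rule topological_tendstoI)
    fix U :: "real set" assume U: "open U" "f l \<in> U"
    then have "openin weak_topology (blinfun_apply f -` U)"
      unfolding weak_topology_def by (intro topology_generated_by_Basis) auto
    with lim U have "eventually (\<lambda>n. s n \<in> blinfun_apply f -` U) F"
      unfolding limitin_def by blast
    then show "eventually (\<lambda>n. f (s n) \<in> U) F" by simp
  qed
next
  assume lim: "\<forall>f :: 'a \<Rightarrow>\<^sub>L real. ((\<lambda>n. f (s n)) \<longlongrightarrow> f l) F"
  have "eventually (\<lambda>n. s n \<in> V) F" if "openin weak_topology V" "l \<in> V" for V
  proof -
    have "generate_topology_on {blinfun_apply f -` U | (f :: 'a \<Rightarrow>\<^sub>L real) U. open U} V"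
      using that unfolding weak_topology_def openin_topology_generated_by_iff by simp
    then show ?thesis using \<open>l \<in> V\<close>
    proof induction
      case (Int a b) then show ?case by (auto intro: eventually_conj)
    next
      case (UN K)
      then obtain k where "k \<in> K" "l \<in> k" by blast
      with UN have "eventually (\<lambda>n. s n \<in> k) F" by blast
      then show ?case by (rule eventually_mono) (use \<open>k \<in> K\<close> in blast)
    next
      case (Basis b)
      then obtain f :: "'a \<Rightarrow>\<^sub>L real" and U
        where fU: "b = blinfun_apply f -` U" "open U" "f l \<in> U" by auto
      from lim have "((\<lambda>n. f (s n)) \<longlongrightarrow> f l) F" by blast
      from topological_tendstoD[OF this fU(2,3)] show ?case by (simp add: fU(1))
    qed auto
  qed
  then show "limitin weak_topology s l F" by (simp add: limitin_def)
qed

definition opial_property :: "'a::banach itself \<Rightarrow> bool" where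
  "opial_property _ \<longleftrightarrow>
     (\<forall>(s :: nat \<Rightarrow> 'a) a. limitin weak_topology s a sequentially \<longrightarrow>
        (\<forall>x. x \<noteq> a \<longrightarrow>
           liminf (\<lambda>n. ereal (norm (s n - a))) < liminf (\<lambda>n. ereal (norm (s n - x)))))"

text \<open>Functions on \<open>X\<close> are represented extensionally (value \<open>undefined\<close> off \<open>X\<close>), so that
  \<open>\<real>\<^sup>X\<close> with pointwise convergence is the library's \<open>product_topology\<close>. The base point is \<open>b\<close>.\<close>

definition internal_functional :: "'a::metric_space set \<Rightarrow> 'a \<Rightarrow> 'a \<Rightarrow> 'a \<Rightarrow> real" where
  "internal_functional X b w = (\<lambda>x\<in>X. dist x w - dist b w)"

definition metric_functionals :: "'a::metric_space set \<Rightarrow> 'a \<Rightarrow> ('a \<Rightarrow> real) set" where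
  "metric_functionals X b =
     product_topology (\<lambda>_. euclideanreal) X closure_of (internal_functional X b ` X)"

text \<open>Changing the base point only adds a constant to each metric functional, so
  quantifying over all base points is the same as fixing one.\<close>

definition unique_minimizer_property :: "'a::metric_space set \<Rightarrow> bool" where
  "unique_minimizer_property X \<longleftrightarrow>
     (\<forall>b\<in>X. \<forall>h\<in>metric_functionals X b. \<exists>a\<in>X. \<forall>x\<in>X - {a}. h a < h x)"

end

theory Submission
  imports Defs
begin

text \<open>
  Let \<open>h\<close> be a metric functional. It is the pointwise limit of the internal functionals
  \<open>h\<^sub>w\<close> along some filter on \<open>X\<close>, and by weak compactness this filter has a weak cluster
  point \<open>a \<in> X\<close>. This \<open>a\<close> is the minimizer. Indeed, fix \<open>x \<noteq> a\<close> in \<open>X\<close> and suppose there is a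
  sequence \<open>w\<^sub>n\<close> converging weakly to \<open>a\<close> with
  \<open>\<parallel>w\<^sub>n - x\<parallel> - \<parallel>w\<^sub>n - a\<parallel> \<longlonglongrightarrow> h x - h a\<close>. Then
  \<open>liminf \<parallel>w\<^sub>n - x\<parallel> = (h x - h a) + liminf \<parallel>w\<^sub>n - a\<parallel>\<close>, and the Opial property forces
  \<open>h x - h a > 0\<close>.

  The difficulty is that the Opial property speaks about sequences, while \<open>h\<close> and \<open>a\<close> come
  from a filter that need not have a countable base. The theorem
  \<open>weakly_compact_cluster_sequence\<close> bridges this gap, in the spirit of Eberlein, Smulian and
  Kaplansky: a weak cluster point of a filter on a weakly compact set is the weak
  limit of a sequence that can moreover be made to satisfy countably many properties that
  hold eventually along the filter. The sequence depends on \<open>x\<close>, whereas \<open>a\<close> does not.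

  The terms \<open>w\<^sub>n\<close> are chosen one after the other so that, for an increasing finite family of
  functionals \<open>\<phi>\<close> of norm at most one, the value \<open>\<phi> (w\<^sub>n)\<close> approaches \<open>\<phi> a\<close>. The family in the end
  contains a norming functional for every rational linear combination of the vectors
  \<open>w\<^sub>i - a\<close>. If \<open>b\<close> is a weak cluster point of the sequence, then \<open>b - a\<close> lies in the
  closed span of these vectors, because closed subspaces are weakly closed, and all
  chosen functionals vanish at it; hence \<open>b = a\<close>. By compactness a sequence with only one
  cluster point converges to it.

  Two consequences of the Hahn--Banach theorem enter: norming functionals and functionals
  separating a point from a closed subspace. Both come from a linear minorant of
  a sublinear functional that touches it at a given point.
\<close>

section \<open>Sublinear functionals and the Hahn--Banach theorem\<close>

definition sublinear :: "('a::real_vector \<Rightarrow> real) \<Rightarrow> bool" where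
  "sublinear p \<longleftrightarrow> (\<forall>x y. p (x + y) \<le> p x + p y) \<and> (\<forall>c\<ge>0. \<forall>x. p (c *\<^sub>R x) = c * p x)"

lemma sublinear_add: "sublinear p \<Longrightarrow> p (x + y) \<le> p x + p y"
  and sublinear_scale: "sublinear p \<Longrightarrow> 0 \<le> c \<Longrightarrow> p (c *\<^sub>R x) = c * p x"
  by (auto simp: sublinear_def)

lemma sublinear_zero: "sublinear p \<Longrightarrow> p 0 = 0"
  using sublinear_scale[of p 0 0] by simp

lemma sublinear_lower_bound: "sublinear p \<Longrightarrow> - p (- x) \<le> p x"
  using sublinear_add[of p x "- x"] sublinear_zero[of p] by simp

text \<open>Only one inequality is needed for homogeneity: applied to \<open>1 / c\<close> it gives its own converse.\<close>

lemma sublinearI: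
  assumes add: "\<And>x y. p (x + y) \<le> p x + p y"
    and scale: "\<And>c x. 0 < c \<Longrightarrow> p (c *\<^sub>R x) \<le> c * p x"
  shows "sublinear p"
proof -
  have "p (c *\<^sub>R x) = c * p x" if "0 \<le> c" for c x
  proof (cases "c = 0")
    case True
    have "p 0 = 0"
      using add[of 0 0] scale[of "1/2" 0] by simp
    then show ?thesis using True by simp
  next
    case False
    with that have c: "0 < c" by simp
    have "p x \<le> inverse c * p (c *\<^sub>R x)"
      using scale[of "inverse c" "c *\<^sub>R x"] c by simp
    then have "c * p x \<le> p (c *\<^sub>R x)"
      using c by (simp add: field_simps)
    with scale[OF c, of x] show ?thesis by simp
  qed
  with add show ?thesis by (simp add: sublinear_def)
qed

text \<open>The three sublinear functionals built below (tilted functionals, infima of chains, distances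
  to a subspace) are all infima of a family whose members need not be sublinear one by one:
  it suffices that sums and multiples are controlled by possibly different members.\<close>

lemma sublinear_INF:
  fixes \<phi> :: "'a::real_vector \<Rightarrow> 'k \<Rightarrow> real"
  assumes "K \<noteq> {}"
    and bdd: "\<And>x. bdd_below (\<phi> x ` K)"
    and add: "\<And>x y k l. k \<in> K \<Longrightarrow> l \<in> K \<Longrightarrow> \<exists>m\<in>K. \<phi> (x + y) m \<le> \<phi> x k + \<phi> y l"
    and scale: "\<And>c x k. 0 < c \<Longrightarrow> k \<in> K \<Longrightarrow> \<exists>m\<in>K. \<phi> (c *\<^sub>R x) m \<le> c * \<phi> x k"
  shows "sublinear (\<lambda>x. INF k\<in>K. \<phi> x k)"
proof (rule sublinearI)
  let ?p = "\<lambda>x. INF k\<in>K. \<phi> x k"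
  fix x y
  have "?p (x + y) - \<phi> x k \<le> ?p y" if k: "k \<in> K" for k
  proof (rule cINF_greatest[OF \<open>K \<noteq> {}\<close>])
    fix l assume "l \<in> K"
    with add[OF k] obtain m where "m \<in> K" "\<phi> (x + y) m \<le> \<phi> x k + \<phi> y l" by blast
    moreover from this have "?p (x + y) \<le> \<phi> (x + y) m" by (intro cINF_lower bdd)
    ultimately show "?p (x + y) - \<phi> x k \<le> \<phi> y l" by linarith
  qed
  then have "?p (x + y) - ?p y \<le> ?p x"
    by (intro cINF_greatest[OF \<open>K \<noteq> {}\<close>]) (simp add: algebra_simps)
  then show "?p (x + y) \<le> ?p x + ?p y" by simp
next
  let ?p = "\<lambda>x. INF k\<in>K. \<phi> x k"
  fix c :: real and x assume c: "0 < c"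
  have "?p (c *\<^sub>R x) / c \<le> ?p x"
  proof (rule cINF_greatest[OF \<open>K \<noteq> {}\<close>])
    fix k assume "k \<in> K"
    with scale[OF c] obtain m where "m \<in> K" "\<phi> (c *\<^sub>R x) m \<le> c * \<phi> x k" by blast
    moreover from this have "?p (c *\<^sub>R x) \<le> \<phi> (c *\<^sub>R x) m" by (intro cINF_lower bdd)
    ultimately show "?p (c *\<^sub>R x) / c \<le> \<phi> x k" using c by (simp add: field_simps)
  qed
  then show "?p (c *\<^sub>R x) \<le> c * ?p x" using c by (simp add: field_simps)
qed

text \<open>The infimum over \<open>t \<ge> 0\<close> of \<open>p (x + t *\<^sub>R y) - t * p y\<close> is a sublinear functional below \<open>p\<close>
  (take \<open>t = 0\<close>) which is at most \<open>- p y\<close> at \<open>- y\<close> (take \<open>t = 1\<close>). Every linear functional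
  below it therefore touches \<open>p\<close> at \<open>y\<close>. It is bounded below because \<open>t *\<^sub>R y\<close> is the sum of
  \<open>x + t *\<^sub>R y\<close> and \<open>- x\<close>.\<close>

lemma sublinear_tilt:
  fixes p :: "'a::real_vector \<Rightarrow> real"
  assumes p: "sublinear p"
  obtains q where "sublinear q" "\<And>x t. 0 \<le> t \<Longrightarrow> q x \<le> p (x + t *\<^sub>R y) - t * p y"
proof
  let ?\<phi> = "\<lambda>x t. p (x + t *\<^sub>R y) - t * p y"
  have bdd: "bdd_below (?\<phi> x ` {0..})" for x
  proof (rule bdd_belowI2)
    fix t :: real assume "t \<in> {0..}"
    then have "t * p y = p ((x + t *\<^sub>R y) + (- x))"
      using sublinear_scale[OF p, of t y] by simp
    also have "\<dots> \<le> p (x + t *\<^sub>R y) + p (- x)" by (rule sublinear_add[OF p])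
    finally show "- p (- x) \<le> ?\<phi> x t" by simp
  qed
  show "sublinear (\<lambda>x. INF t\<in>{0..}. ?\<phi> x t)"
  proof (rule sublinear_INF[OF _ bdd])
    fix x z and s t :: real assume "s \<in> {0..}" "t \<in> {0..}"
    then show "\<exists>m\<in>{0..}. ?\<phi> (x + z) m \<le> ?\<phi> x s + ?\<phi> z t"
      using sublinear_add[OF p, of "x + s *\<^sub>R y" "z + t *\<^sub>R y"]
      by (intro bexI[of _ "s + t"]) (auto simp: algebra_simps)
  next
    fix c t :: real and x assume c: "0 < c" and "t \<in> {0..}"
    then show "\<exists>m\<in>{0..}. ?\<phi> (c *\<^sub>R x) m \<le> c * ?\<phi> x t"
      using sublinear_scale[OF p, of c "x + t *\<^sub>R y"]
      by (intro bexI[of _ "c * t"]) (auto simp: algebra_simps)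
  qed simp
  show "(INF t\<in>{0..}. ?\<phi> x t) \<le> ?\<phi> x t" if "0 \<le> t" for x t
    using that by (intro cINF_lower[OF bdd]) simp
qed

text \<open>Zorn's lemma on the sublinear functionals below \<open>p\<close>. The pointwise infimum of a chain exists
  since every such \<open>q\<close> satisfies \<open>q x \<ge> - q (- x) \<ge> - p (- x)\<close>.\<close>

lemma minimal_sublinear_exists:
  fixes p :: "'a::real_vector \<Rightarrow> real"
  assumes p: "sublinear p"
  obtains q where "sublinear q" "q \<le> p" "\<And>r. sublinear r \<Longrightarrow> r \<le> q \<Longrightarrow> r = q"
proof -
  define A where "A = {q. sublinear q \<and> q \<le> p}"
  let ?R = "relation_of (\<lambda>f g. g \<le> f) A"
  have "\<exists>m\<in>A. \<forall>a\<in>A. a \<le> m \<longrightarrow> a = m"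
  proof (rule predicate_Zorn)
    show "partial_order_on A ?R"
      by (rule partial_order_on_relation_ofI) auto
  next
    fix C assume C: "C \<in> Chains ?R"
    then have CA: "C \<subseteq> A" by (auto simp: Chains_def relation_of_def)
    have total: "f \<le> g \<or> g \<le> f" if "f \<in> C" "g \<in> C" for f g
      using C that by (auto simp: Chains_def relation_of_def)
    show "\<exists>u\<in>A. \<forall>a\<in>C. u \<le> a"
    proof (cases "C = {}")
      case True
      then show ?thesis using p by (auto simp: A_def)
    next
      case False
      let ?u = "\<lambda>x. INF q\<in>C. q x"
      have bdd: "bdd_below ((\<lambda>q. q x) ` C)" for x
      proof (rule bdd_belowI2)
        fix q assume "q \<in> C"
        then have "sublinear q" "q (- x) \<le> p (- x)"
          using CA by (auto simp: A_def le_fun_def)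
        then show "- p (- x) \<le> q x" using sublinear_lower_bound[of q x] by linarith
      qed
      have "sublinear ?u"
      proof (rule sublinear_INF[OF False bdd])
        fix x y f g assume fg: "f \<in> C" "g \<in> C"
        \<comment> \<open>The smaller of two members of the chain works for both summands.\<close>
        then obtain m where m: "m \<in> C" "m \<le> f" "m \<le> g"
          using total[OF fg] by auto
        then have "m (x + y) \<le> m x + m y"
          using CA by (auto simp: A_def sublinear_add)
        also have "m x + m y \<le> f x + g y"
          using m by (intro add_mono) (auto simp: le_fun_def)
        finally show "\<exists>m\<in>C. m (x + y) \<le> f x + g y" using m(1) by blast
      next
        fix c :: real and x f assume "0 < c" "f \<in> C"
        then show "\<exists>m\<in>C. m (c *\<^sub>R x) \<le> c * f x"
          using CA by (intro bexI[of _ f]) (auto simp: A_def sublinear_scale)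
      qed
      moreover have below: "?u \<le> q" if "q \<in> C" for q
        using that by (auto simp: le_fun_def intro!: cINF_lower[OF bdd])
      moreover have "?u \<le> p"
      proof -
        from False obtain q where "q \<in> C" by blast
        with below CA show ?thesis unfolding A_def by (blast intro: order_trans)
      qed
      ultimately show ?thesis by (intro bexI[of _ ?u]) (auto simp: A_def)
    qed
  qed
  then obtain q where "q \<in> A" "\<And>r. r \<in> A \<Longrightarrow> r \<le> q \<Longrightarrow> r = q" by blast
  then show thesis
    by (intro that[of q]) (auto simp: A_def intro: order_trans)
qed

text \<open>A minimal \<open>q\<close> equals all its tilts, so \<open>q x \<le> q (x + y) - q y\<close>; together with
  subadditivity this is additivity. This replaces the usual extension of a functional from a
  subspace, one dimension at a time.\<close>

lemma minimal_sublinear_linear: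
  fixes q :: "'a::real_vector \<Rightarrow> real"
  assumes q: "sublinear q" and minimal: "\<And>r. sublinear r \<Longrightarrow> r \<le> q \<Longrightarrow> r = q"
  shows "linear q"
proof -
  have add: "q (x + y) = q x + q y" for x y
  proof -
    obtain r where r: "sublinear r" "\<And>x t. 0 \<le> t \<Longrightarrow> r x \<le> q (x + t *\<^sub>R y) - t * q y"
      using sublinear_tilt[OF q] by blast
    have "r \<le> q" using r(2)[of 0] by (auto simp: le_fun_def)
    then have "r = q" by (rule minimal[OF r(1)])
    then have "q x \<le> q (x + y) - q y" using r(2)[of 1 x] by simp
    with sublinear_add[OF q, of x y] show ?thesis by simp
  qed
  have neg: "q (- x) = - q x" for x
    using add[of x "- x"] sublinear_zero[OF q] by simp
  have "q (c *\<^sub>R x) = c * q x" for c x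
  proof (cases "0 \<le> c")
    case False
    then have "q (c *\<^sub>R x) = - q ((- c) *\<^sub>R x)" using neg[of "(- c) *\<^sub>R x"] by simp
    with False show ?thesis using sublinear_scale[OF q, of "- c" x] by simp
  qed (simp add: sublinear_scale[OF q])
  with add show ?thesis by (simp add: linear_iff)
qed

text \<open>Take a minimal sublinear functional below the tilt of \<open>p\<close> in the direction \<open>y\<close>.\<close>

theorem Hahn_Banach_sublinear:
  fixes p :: "'a::real_vector \<Rightarrow> real"
  assumes p: "sublinear p"
  obtains f where "linear f" "\<And>x. f x \<le> p x" "f y = p y"
proof -
  obtain r where r: "sublinear r" "\<And>x t. 0 \<le> t \<Longrightarrow> r x \<le> p (x + t *\<^sub>R y) - t * p y"
    using sublinear_tilt[OF p] by blast
  obtain f where f: "sublinear f" "f \<le> r" "\<And>g. sublinear g \<Longrightarrow> g \<le> f \<Longrightarrow> g = f"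
    using minimal_sublinear_exists[OF r(1)] by blast
  have lin: "linear f" using f(1,3) by (rule minimal_sublinear_linear)
  have le: "f x \<le> p x" for x
    using r(2)[of 0 x] f(2) by (auto simp: le_fun_def intro: order_trans)
  have "f (- y) \<le> r (- y)" using f(2) by (simp add: le_fun_def)
  also have "\<dots> \<le> - p y" using r(2)[of 1 "- y"] sublinear_zero[OF p] by simp
  finally have "p y \<le> f y" using linear_neg[OF lin, of y] by simp
  with le[of y] have "f y = p y" by simp
  with lin le show thesis by (rule that)
qed

lemma blinfun_dominated:
  fixes f :: "'a::real_normed_vector \<Rightarrow> real"
  assumes lin: "linear f" and le: "\<And>x. f x \<le> norm x"
  obtains g :: "'a \<Rightarrow>\<^sub>L real" where "blinfun_apply g = f" "\<And>x. \<bar>f x\<bar> \<le> norm x"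
proof -
  have abs: "\<bar>f x\<bar> \<le> norm x" for x
    using le[of x] le[of "- x"] linear_neg[OF lin, of x] by simp
  have "bounded_linear f"
    using lin by (rule bounded_linear.intro[unfolded bounded_linear_axioms_def])
      (auto intro!: exI[of _ 1] abs)
  then show thesis by (intro that[of "Blinfun f"] abs) (rule bounded_linear_Blinfun_apply)
qed

lemma norming_functional:
  fixes y :: "'a::real_normed_vector"
  obtains f :: "'a \<Rightarrow>\<^sub>L real" where "\<And>x. \<bar>f x\<bar> \<le> norm x" "f y = norm y"
proof -
  have "sublinear (norm :: 'a \<Rightarrow> real)"
    by (simp add: sublinear_def norm_triangle_ineq)
  then obtain f where "linear f" "\<And>x. f x \<le> norm x" "f y = norm y"
    using Hahn_Banach_sublinear by blast
  then show thesis using blinfun_dominated[of f] that by metis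
qed

lemma separating_functional_subspace:
  fixes S :: "'a::real_normed_vector set"
  assumes S: "subspace S"
  obtains f :: "'a \<Rightarrow>\<^sub>L real" where "\<And>x. x \<in> S \<Longrightarrow> f x = 0" "f y = infdist y S"
proof -
  have S0: "S \<noteq> {}" using subspace_0[OF S] by blast
  have "sublinear (\<lambda>x. INF s\<in>S. dist x s)"
  proof (rule sublinear_INF[OF S0])
    fix x y s t assume "s \<in> S" "t \<in> S"
    then show "\<exists>m\<in>S. dist (x + y) m \<le> dist x s + dist y t"
      by (intro bexI[of _ "s + t"] dist_triangle_add subspace_add[OF S])
  next
    fix c :: real and x s assume "0 < c" "s \<in> S"
    then show "\<exists>m\<in>S. dist (c *\<^sub>R x) m \<le> c * dist x s"
      by (intro bexI[of _ "c *\<^sub>R s"] subspace_scale[OF S])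
        (auto simp: dist_norm simp flip: scaleR_diff_right)
  qed auto
  then have "sublinear (\<lambda>x. infdist x S)" by (simp add: infdist_notempty[OF S0])
  then obtain f where f: "linear f" "\<And>x. f x \<le> infdist x S" "f y = infdist y S"
    using Hahn_Banach_sublinear by blast
  have "f x \<le> norm x" for x
    using f(2)[of x] infdist_le[OF subspace_0[OF S], of x] by simp
  then obtain g :: "'a \<Rightarrow>\<^sub>L real" where g: "blinfun_apply g = f"
    using blinfun_dominated[OF f(1)] by blast
  have "f x = 0" if "x \<in> S" for x
    using f(2)[of x] f(2)[of "- x"] that subspace_neg[OF S that] linear_neg[OF f(1), of x] by simp
  with f(3) g show thesis by (intro that[of g]) auto
qed

section \<open>Cluster points in compact sets\<close>

text \<open>Stated for a family indexed along a filter, so that it covers both a filter on the set itself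
  (with \<open>s\<close> the identity) and a sequence restricted to infinitely many indices.\<close>

definition cluster_point :: "'a topology \<Rightarrow> ('i \<Rightarrow> 'a) \<Rightarrow> 'i filter \<Rightarrow> 'a \<Rightarrow> bool" where
  "cluster_point T s F b \<longleftrightarrow> (\<forall>V. openin T V \<longrightarrow> b \<in> V \<longrightarrow> (\<exists>\<^sub>F n in F. s n \<in> V))"

lemma cluster_pointD:
  "cluster_point T s F b \<Longrightarrow> openin T V \<Longrightarrow> b \<in> V \<Longrightarrow> \<exists>\<^sub>F n in F. s n \<in> V"
  by (simp add: cluster_point_def)

text \<open>Otherwise every point of \<open>X\<close> has a neighbourhood that \<open>s\<close> eventually avoids; finitely many of
  these cover \<open>X\<close>, so \<open>s\<close> would eventually avoid \<open>X\<close>.\<close>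

lemma compactin_cluster_point:
  assumes X: "compactin T X" and F: "F \<noteq> bot" and ev: "\<forall>\<^sub>F n in F. s n \<in> X"
  obtains b where "b \<in> X" "cluster_point T s F b"
proof (rule ccontr)
  assume none: "\<not> thesis"
  define \<U> where "\<U> = {V. openin T V \<and> (\<forall>\<^sub>F n in F. s n \<notin> V)}"
  have "X \<subseteq> \<Union>\<U>"
  proof
    fix b assume "b \<in> X"
    with none that have "\<not> cluster_point T s F b" by blast
    then show "b \<in> \<Union>\<U>" by (auto simp: \<U>_def cluster_point_def frequently_def)
  qed
  then obtain \<F> where \<F>: "finite \<F>" "\<F> \<subseteq> \<U>" "X \<subseteq> \<Union>\<F>"
    using compactinD[OF X, of \<U>] by (auto simp: \<U>_def)
  have "\<forall>\<^sub>F n in F. \<forall>V\<in>\<F>. s n \<notin> V"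
    using \<F> by (intro eventually_ball_finite) (auto simp: \<U>_def)
  with ev have "\<forall>\<^sub>F n in F. False"
    by eventually_elim (use \<F> in blast)
  with F show False by simp
qed

lemma openin_weak_topology_vimage:
  fixes f :: "'a::real_normed_vector \<Rightarrow>\<^sub>L real"
  shows "open U \<Longrightarrow> openin weak_topology (blinfun_apply f -` U)"
  unfolding weak_topology_def by (intro topology_generated_by_Basis) auto

lemma weak_cluster_point_closed:
  fixes f :: "'a::real_normed_vector \<Rightarrow>\<^sub>L real"
  assumes cluster: "cluster_point weak_topology s F b"
    and "closed C" and ev: "\<forall>\<^sub>F n in F. f (s n) \<in> C"
  shows "f b \<in> C"
proof (rule ccontr)
  assume "f b \<notin> C"
  then have "\<exists>\<^sub>F n in F. s n \<in> blinfun_apply f -` (- C)"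
    using \<open>closed C\<close> by (intro cluster_pointD[OF cluster] openin_weak_topology_vimage) auto
  with ev show False by (auto simp: frequently_def elim: eventually_mono)
qed

lemma weak_cluster_point_limit:
  fixes f :: "'a::real_normed_vector \<Rightarrow>\<^sub>L real"
  assumes cluster: "cluster_point weak_topology s F b"
    and lim: "((\<lambda>n. f (s n)) \<longlongrightarrow> l) F"
  shows "f b = l"
proof (rule ccontr)
  assume "f b \<noteq> l"
  define e where "e = dist (f b) l / 2"
  have e: "0 < e" using \<open>f b \<noteq> l\<close> by (simp add: e_def)
  have "\<forall>\<^sub>F n in F. f (s n) \<in> cball l e"
    using tendstoD[OF lim e] by eventually_elim (simp add: dist_commute)
  then have "f b \<in> cball l e" by (rule weak_cluster_point_closed[OF cluster closed_cball])
  then show False using e by (simp add: e_def dist_commute)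
qed

section \<open>Rational linear combinations\<close>

text \<open>Lists of coefficient-index pairs form a countable type, and a combination is evaluated on any
  family \<open>u\<close>. All combinations can thus be enumerated before the family is known,
  which the recursive choice of a sequence below relies on.\<close>

definition rat_comb :: "(rat \<times> nat) list \<Rightarrow> (nat \<Rightarrow> 'a::real_vector) \<Rightarrow> 'a" where
  "rat_comb xs u = (\<Sum>(q, i)\<leftarrow>xs. of_rat q *\<^sub>R u i)"

lemma rat_comb_append: "rat_comb (xs @ ys) u = rat_comb xs u + rat_comb ys u"
  by (simp add: rat_comb_def)

lemma rat_comb_scale:
  "rat_comb (map (\<lambda>(q, i). (r * q, i)) xs) u = of_rat r *\<^sub>R rat_comb xs u"
  by (induction xs) (auto simp: rat_comb_def of_rat_mult scaleR_add_right)

lemma rat_comb_cong: "(\<And>i. i \<in> snd ` set xs \<Longrightarrow> u i = v i) \<Longrightarrow> rat_comb xs u = rat_comb xs v"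
  by (induction xs) (auto simp: rat_comb_def)

text \<open>The closure is invariant under rational scalars, and the set of scalars mapping a given point
  into it is closed, hence contains all reals.\<close>

lemma subspace_closure_rat_comb:
  fixes u :: "nat \<Rightarrow> 'a::real_normed_vector"
  shows "subspace (closure (range (\<lambda>xs. rat_comb xs u)))" (is "subspace (closure ?R)")
proof (rule subspaceI)
  have "rat_comb [] u \<in> closure ?R" by (intro subsetD[OF closure_subset]) blast
  then show "0 \<in> closure ?R" by (simp add: rat_comb_def)
next
  fix x y assume "x \<in> closure ?R" "y \<in> closure ?R"
  then obtain s t where "\<And>n. s n \<in> ?R" "s \<longlonglongrightarrow> x" "\<And>n. t n \<in> ?R" "t \<longlonglongrightarrow> y"
    by (metis closure_sequential)
  moreover have "a + b \<in> ?R" if "a \<in> ?R" "b \<in> ?R" for a b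
    using that by (auto simp flip: rat_comb_append)
  ultimately have "\<And>n. s n + t n \<in> ?R" "(\<lambda>n. s n + t n) \<longlonglongrightarrow> x + y"
    by (auto intro: tendsto_add simp del: image_iff)
  then show "x + y \<in> closure ?R"
    unfolding closure_sequential by (intro exI[of _ "\<lambda>n. s n + t n"]) auto
next
  fix c :: real and x assume x: "x \<in> closure ?R"
  have "(\<lambda>y. of_rat q *\<^sub>R y) ` closure ?R \<subseteq> closure ?R" for q
  proof (rule image_closure_subset)
    show "(\<lambda>y. of_rat q *\<^sub>R y) ` ?R \<subseteq> closure ?R"
      by (rule order_trans[OF _ closure_subset]) (auto simp flip: rat_comb_scale)
  qed (auto intro!: continuous_intros)
  then have "\<rat> \<subseteq> (\<lambda>c. c *\<^sub>R x) -` closure ?R"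
    using x by (auto simp: Rats_def)
  moreover have "closed ((\<lambda>c. c *\<^sub>R x) -` closure ?R)"
    by (intro continuous_closed_vimage) (auto intro!: continuous_intros)
  ultimately have "closure \<rat> \<subseteq> (\<lambda>c. c *\<^sub>R x) -` closure ?R" by (rule closure_minimal)
  then show "c *\<^sub>R x \<in> closure ?R" by (auto simp: Rats_closure_real)
qed

section \<open>From cluster points to weakly convergent sequences\<close>

text \<open>If \<open>c \<in> R\<close> is close to \<open>z\<close>, then \<open>\<parallel>c\<parallel> = \<phi> c c = \<phi> c (c - z)\<close> is small, and so is \<open>\<parallel>z\<parallel>\<close>.\<close>

lemma zero_of_vanishing_norming_functionals:
  fixes R :: "'a::real_normed_vector set" and \<phi> :: "'a \<Rightarrow> 'a \<Rightarrow>\<^sub>L real"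
  assumes \<phi>: "\<And>c x. \<bar>\<phi> c x\<bar> \<le> norm x" "\<And>c. \<phi> c c = norm c"
    and z: "z \<in> closure R" "\<And>c. c \<in> R \<Longrightarrow> \<phi> c z = 0"
  shows "z = 0"
proof (rule ccontr)
  assume "z \<noteq> 0"
  then obtain c where c: "c \<in> R" "dist c z < norm z / 2"
    using z(1) unfolding closure_approachable by (metis half_gt_zero_iff zero_less_norm_iff)
  have "norm c = \<phi> c (c - z)" by (simp add: blinfun.diff_right \<phi>(2) z(2)[OF c(1)])
  also have "\<dots> \<le> norm (c - z)" using \<phi>(1)[of c "c - z"] by simp
  finally have "norm c \<le> dist c z" by (simp add: dist_norm)
  moreover have "norm z \<le> norm c + dist c z"
    using norm_triangle_sub[of z c] by (simp add: dist_norm norm_minus_commute)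
  ultimately show False using c(2) by linarith
qed

text \<open>The filter may have no countable base, yet countably many conditions suffice to pin down
  a weakly convergent sequence: weak compactness leaves only cluster points \<open>b\<close> with \<open>b - a\<close> in
  the separable closed span of the vectors \<open>w n - a\<close>, and countably many functionals detect
  whether an element of that span is zero.\<close>

theorem weakly_compact_cluster_sequence:
  fixes X :: "'a::real_normed_vector set"
  assumes X: "compactin weak_topology X"
    and FX: "\<forall>\<^sub>F w in F. w \<in> X"
    and cluster: "cluster_point weak_topology (\<lambda>w. w) F a"
    and P: "\<And>n::nat. \<forall>\<^sub>F w in F. P n w"
  obtains w where "limitin weak_topology w a sequentially" "\<And>n. P n (w n)"
proof -
  have "\<exists>f :: 'a \<Rightarrow>\<^sub>L real. (\<forall>x. \<bar>f x\<bar> \<le> norm x) \<and> f y = norm y" for y :: 'a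
    using norming_functional[of y] by metis
  then obtain \<phi> :: "'a \<Rightarrow> 'a \<Rightarrow>\<^sub>L real"
    where \<phi>: "\<And>c x. \<bar>\<phi> c x\<bar> \<le> norm x" "\<And>c. \<phi> c c = norm c" by metis
  \<comment> \<open>At stage \<open>n\<close> only \<open>w 0, \<dots>, w (n - 1)\<close> are known, so later terms are replaced by \<open>0\<close>.
    For \<open>n\<close> large the \<open>k\<close>-th combination no longer sees the replacement.\<close>
  define comb where "comb k n u = rat_comb (from_nat k) (\<lambda>i. if i < n then u i - a else 0)"
    for k n and u :: "nat \<Rightarrow> 'a"
  define Q where "Q u n v \<longleftrightarrow> v \<in> X \<and> P n v \<and>
      (\<forall>k\<le>n. \<bar>\<phi> (comb k n u) v - \<phi> (comb k n u) a\<bar> < 1 / real (Suc n))" for u n v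
  have "\<exists>w. \<forall>n. Q w n (w n)"
  proof (rule dependent_wf_choice[OF wf_less_than])
    fix u v :: "nat \<Rightarrow> 'a" and n r
    assume "\<And>i. (i, n) \<in> less_than \<Longrightarrow> u i = v i"
    then have "comb k n u = comb k n v" for k
      unfolding comb_def by (intro rat_comb_cong) auto
    then show "Q u n r = Q v n r" by (simp add: Q_def)
  next
    fix n and u :: "nat \<Rightarrow> 'a"
    let ?V = "\<lambda>k. blinfun_apply (\<phi> (comb k n u)) -` ball (\<phi> (comb k n u) a) (1 / real (Suc n))"
    have "openin weak_topology (\<Inter>k\<in>{..n}. ?V k)"
      by (intro openin_INT2 openin_weak_topology_vimage) auto
    then have "\<exists>\<^sub>F w in F. w \<in> (\<Inter>k\<in>{..n}. ?V k)" by (rule cluster_pointD[OF cluster]) simp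
    from frequently_eventually_frequently[OF this eventually_conj[OF FX P[of n]]]
    obtain w where "w \<in> (\<Inter>k\<in>{..n}. ?V k)" "w \<in> X" "P n w"
      by (auto dest: frequently_ex)
    then show "\<exists>w. Q u n w" by (auto simp: Q_def dist_real_def abs_minus_commute)
  qed
  then obtain w where w: "\<And>n. Q w n (w n)" by blast
  define u where "u n = w n - a" for n
  define R where "R = range (\<lambda>xs. rat_comb xs u)"
  have wX: "w n \<in> X" and Pw: "P n (w n)" for n using w[of n] by (auto simp: Q_def)
  have norming_lim: "(\<lambda>n. \<phi> c (w n)) \<longlonglongrightarrow> \<phi> c a" if c: "c \<in> R" for c
  proof -
    obtain xs where xs: "c = rat_comb xs u" using c by (auto simp: R_def)
    obtain N where N: "\<And>i. i \<in> snd ` set xs \<Longrightarrow> i < N"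
      using finite_nat_set_iff_bounded[of "snd ` set xs"] by auto
    have close: "\<bar>\<phi> c (w n) - \<phi> c a\<bar> < 1 / real (Suc n)" if n: "max N (to_nat xs) \<le> n" for n
    proof -
      have "i < n" if "i \<in> snd ` set xs" for i using N[OF that] n by simp
      then have "comb (to_nat xs) n w = c"
        unfolding comb_def xs from_nat_to_nat by (intro rat_comb_cong) (simp add: u_def)
      with w[of n] n show ?thesis unfolding Q_def by auto
    qed
    have "(\<lambda>n. \<phi> c (w n) - \<phi> c a) \<longlonglongrightarrow> 0"
    proof (rule Lim_null_comparison)
      show "\<forall>\<^sub>F n in sequentially. norm (\<phi> c (w n) - \<phi> c a) \<le> 1 / real (Suc n)"
        using eventually_ge_at_top[of "max N (to_nat xs)"]
        by eventually_elim (use close in \<open>auto intro: less_imp_le\<close>)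
      show "(\<lambda>n. 1 / real (Suc n)) \<longlonglongrightarrow> 0" by (rule LIMSEQ_Suc[OF lim_1_over_n])
    qed
    then show ?thesis by (simp add: LIM_zero_iff)
  qed
  have subspace: "subspace (closure R)" unfolding R_def by (rule subspace_closure_rat_comb)
  have uR: "u n \<in> closure R" for n
  proof -
    have "rat_comb [(1, n)] u \<in> R" by (auto simp: R_def)
    then show ?thesis using closure_subset by (auto simp: rat_comb_def)
  qed
  have unique: "b = a"
    if G: "G \<le> sequentially" "G \<noteq> bot"
      and b: "cluster_point weak_topology w G b" for b G
  proof -
    \<comment> \<open>A functional that vanishes on all \<open>u n\<close> is constant along the sequence, so it cannot
      separate \<open>b - a\<close> from the closed span.\<close>
    obtain f :: "'a \<Rightarrow>\<^sub>L real"
      where f: "\<And>x. x \<in> closure R \<Longrightarrow> f x = 0" "f (b - a) = infdist (b - a) (closure R)"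
      using separating_functional_subspace[OF subspace] by blast
    have "f (w n) = f a" for n
      using f(1)[OF uR, of n] by (simp add: u_def blinfun.diff_right)
    then have "f b = f a" by (intro weak_cluster_point_limit[OF b]) auto
    then have "infdist (b - a) (closure R) = 0" using f(2) by (simp add: blinfun.diff_right)
    then have "b - a \<in> closure R"
      using in_closure_iff_infdist_zero[of "closure R" "b - a"] by (auto simp: R_def)
    moreover have "\<phi> c (b - a) = 0" if "c \<in> R" for c
      using weak_cluster_point_limit[OF b tendsto_mono[OF G(1) norming_lim[OF that]]]
      by (simp add: blinfun.diff_right)
    ultimately have "b - a = 0" by (rule zero_of_vanishing_norming_functionals[OF \<phi>])
    then show ?thesis by simp
  qed
  have "(\<lambda>n. g (w n)) \<longlonglongrightarrow> g a" for g :: "'a \<Rightarrow>\<^sub>L real"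
  proof (rule ccontr)
    assume "\<not> (\<lambda>n. g (w n)) \<longlonglongrightarrow> g a"
    then obtain e where e: "0 < e" "\<exists>\<^sub>F n in sequentially. \<not> dist (g (w n)) (g a) < e"
      by (auto simp: tendsto_iff not_eventually)
    \<comment> \<open>The sequence restricted to the infinitely many indices that stay away from the limit.\<close>
    define G where "G = inf sequentially (principal {n. \<not> dist (g (w n)) (g a) < e})"
    have G: "G \<le> sequentially" "G \<noteq> bot"
      using e(2) by (auto simp: G_def trivial_limit_def eventually_inf_principal frequently_def)
    obtain b where b: "cluster_point weak_topology w G b"
      using compactin_cluster_point[OF X G(2), of w] wX by auto
    have "\<forall>\<^sub>F n in G. g (w n) \<in> - ball (g a) e"
      by (auto simp: G_def eventually_inf_principal dist_commute)
    then have "g b \<in> - ball (g a) e" by (intro weak_cluster_point_closed[OF b]) auto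
    with unique[OF G b] e(1) show False by simp
  qed
  then have "limitin weak_topology w a sequentially" by (simp add: limitin_weak_topology)
  then show thesis using Pw by (rule that)
qed

section \<open>Minimizers of metric functionals\<close>

text \<open>The two limes inferiors in the Opial property differ by \<open>d\<close>. The smaller one
  may a priori be infinite, but then it could not be strictly smaller.\<close>

lemma opial_property_strict:
  fixes w :: "nat \<Rightarrow> 'a::banach"
  assumes opial: "opial_property TYPE('a)" and w: "limitin weak_topology w a sequentially"
    and "x \<noteq> a" and D: "(\<lambda>n. dist x (w n) - dist a (w n)) \<longlonglongrightarrow> d"
  shows "0 < d"
proof -
  let ?L = "liminf (\<lambda>n. ereal (norm (w n - a)))"
  have "?L < liminf (\<lambda>n. ereal (norm (w n - x)))"
    using opial w \<open>x \<noteq> a\<close> by (auto simp: opial_property_def)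
  also have "(\<lambda>n. ereal (norm (w n - x)))
      = (\<lambda>n. ereal (dist x (w n) - dist a (w n)) + ereal (norm (w n - a)))"
    by (simp add: dist_norm norm_minus_commute)
  also have "liminf \<dots> = ereal d + ?L"
    using D by (intro ereal_liminf_lim_add) auto
  finally show ?thesis by (cases ?L) auto
qed

text \<open>Membership in a closure is expressed by a filter on \<open>X\<close> itself, the pullback of the
  neighbourhood filter of \<open>h\<close> along \<open>w \<mapsto> h\<^sub>w\<close>, so that weak compactness of \<open>X\<close> applies to it.\<close>

lemma metric_functional_filter:
  assumes h: "h \<in> metric_functionals X b"
  obtains F where "F \<noteq> bot" "\<forall>\<^sub>F w in F. w \<in> X"
    "\<And>x. x \<in> X \<Longrightarrow> ((\<lambda>w. internal_functional X b w x) \<longlongrightarrow> h x) F"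
proof
  let ?T = "product_topology (\<lambda>_. euclideanreal) X"
  let ?F = "inf (filtercomap (internal_functional X b) (nhdsin ?T h)) (principal X)"
  have top: "h \<in> topspace ?T"
    and meets: "\<And>N. openin ?T N \<Longrightarrow> h \<in> N \<Longrightarrow> \<exists>w\<in>X. internal_functional X b w \<in> N"
    using h unfolding metric_functionals_def in_closure_of by blast+
  have ev: "eventually P ?F \<longleftrightarrow>
      (\<exists>N. openin ?T N \<and> h \<in> N \<and> (\<forall>w\<in>X. internal_functional X b w \<in> N \<longrightarrow> P w))" for P
  proof
    assume "eventually P ?F"
    then obtain Q N where "openin ?T N" "h \<in> N" "\<forall>g\<in>N. Q g"
      and "\<And>w. Q (internal_functional X b w) \<Longrightarrow> w \<in> X \<Longrightarrow> P w"
      unfolding eventually_inf_principal eventually_filtercomap eventually_nhdsin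
      using top by auto
    then show "\<exists>N. openin ?T N \<and> h \<in> N \<and> (\<forall>w\<in>X. internal_functional X b w \<in> N \<longrightarrow> P w)"
      by (intro exI[of _ N]) auto
  next
    assume "\<exists>N. openin ?T N \<and> h \<in> N \<and> (\<forall>w\<in>X. internal_functional X b w \<in> N \<longrightarrow> P w)"
    then obtain N where "openin ?T N" "h \<in> N"
      "\<And>w. w \<in> X \<Longrightarrow> internal_functional X b w \<in> N \<Longrightarrow> P w" by blast
    then show "eventually P ?F"
      unfolding eventually_inf_principal eventually_filtercomap eventually_nhdsin
      by (intro exI[of _ "\<lambda>g. g \<in> N"]) auto
  qed
  show "?F \<noteq> bot" unfolding trivial_limit_def ev using meets by blast
  show "\<forall>\<^sub>F w in ?F. w \<in> X" by (simp add: eventually_inf_principal)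
  show "((\<lambda>w. internal_functional X b w x) \<longlongrightarrow> h x) ?F" if "x \<in> X" for x
  proof (rule topological_tendstoI)
    fix U assume U: "open U" "h x \<in> U"
    have "continuous_map ?T euclideanreal (\<lambda>g. g x)"
      by (rule continuous_map_product_projection[OF that])
    then have "openin ?T {g \<in> topspace ?T. g x \<in> U}"
      using U by (intro openin_continuous_map_preimage) auto
    with top U show "\<forall>\<^sub>F w in ?F. internal_functional X b w x \<in> U"
      unfolding ev by (intro exI[of _ "{g \<in> topspace ?T. g x \<in> U}"]) blast
  qed
qed

theorem proposition4p22:
  fixes X :: "'a::banach set"
  assumes "opial_property TYPE('a)"
    and "X \<noteq> {}"
    and "compactin weak_topology X"
  shows "unique_minimizer_property X"
  unfolding unique_minimizer_property_def
proof (intro ballI)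
  fix b h assume "b \<in> X" and h: "h \<in> metric_functionals X b"
  let ?I = "internal_functional X b"
  obtain F where F: "F \<noteq> bot" "\<forall>\<^sub>F w in F. w \<in> X"
    and Fh: "\<And>x. x \<in> X \<Longrightarrow> ((\<lambda>w. ?I w x) \<longlongrightarrow> h x) F"
    using metric_functional_filter[OF h] by blast
  obtain a where a: "a \<in> X"
    and cluster: "cluster_point weak_topology (\<lambda>w. w) F a"
    using compactin_cluster_point[OF assms(3) F] by blast
  show "\<exists>a\<in>X. \<forall>x\<in>X - {a}. h a < h x"
  proof (intro bexI[OF _ a] ballI)
    fix x assume x: "x \<in> X - {a}"
    have D: "((\<lambda>w. ?I w x - ?I w a) \<longlongrightarrow> h x - h a) F"
      using x a by (intro tendsto_diff Fh) auto
    have "\<forall>\<^sub>F w in F. dist (?I w x - ?I w a) (h x - h a) < 1 / real (Suc n)" for n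
      by (rule tendstoD[OF D]) simp
    then obtain w where w: "limitin weak_topology w a sequentially"
      and near: "\<And>n. dist (?I (w n) x - ?I (w n) a) (h x - h a) < 1 / real (Suc n)"
      by (rule weakly_compact_cluster_sequence[OF assms(3) F(2) cluster,
            where P = "\<lambda>n w. dist (?I w x - ?I w a) (h x - h a) < 1 / real (Suc n)"]) blast
    have "(\<lambda>n. (?I (w n) x - ?I (w n) a) - (h x - h a)) \<longlonglongrightarrow> 0"
    proof (rule Lim_null_comparison)
      show "\<forall>\<^sub>F n in sequentially.
          norm ((?I (w n) x - ?I (w n) a) - (h x - h a)) \<le> 1 / real (Suc n)"
        using near by (intro always_eventually allI less_imp_le) (simp add: dist_norm)
      show "(\<lambda>n. 1 / real (Suc n)) \<longlonglongrightarrow> 0" by (rule LIMSEQ_Suc[OF lim_1_over_n])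
    qed
    then have "(\<lambda>n. ?I (w n) x - ?I (w n) a) \<longlonglongrightarrow> h x - h a" by (simp only: LIM_zero_iff)
    then have "(\<lambda>n. dist x (w n) - dist a (w n)) \<longlonglongrightarrow> h x - h a"
      using x a by (simp add: internal_functional_def)
    then have "0 < h x - h a"
      using x by (intro opial_property_strict[OF assms(1) w]) auto
    then show "h a < h x" by simp
  qed
qed

end
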